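(* Let $J=\{1,\dots,n\}$, $M=\{1,\dots,m\}$, processing times $p_{i,j}>0$ and release date intervals $R_j=[r_j^-,r_j^+]$ with $0\le r_j^-<r_j^+$ ($i\in M$, $j\in J$) be given, let $R=R_1\times\dots\times R_n$, and for $j\in J$ let $\bar r^j\in R$ be the scenario in which job $j$ has release date $r_j^+$ and every other job $t\ne j$ has release date $r_t^-$. Let $\bar R=\{\bar r^1,\dots,\bar r^n\}$. Then for every schedule $x$ the worst-case scenario belongs to $\bar R$, i.e. the maximum of the regret $Q(x,r)$ over $r\in R$ is attained at an element of $\bar R$: $$\max_{r\in R}Q(x,r)=\max_{\bar r\in\bar R}Q(x,\bar r).$$
   Context: Jobs $J=\{1,\dots,n\}$ are independent and non-preemptive and are processed on unrelated parallel machines $M=\{1,\dots,m\}$; $p_{i,j}>0$ is the processing time of job $j$ on machine $i$. The release date $r_j$ of job $j$ is uncertain and lies in $R_j=[r_j^-,r_j^+]$; a scenario is a vector $r=(r_1,\dots,r_n)\in R=R_1\times\dots\times R_n$. A schedule is a binary array $x=[x_{i,k,j}]$, $i\in M$, $k,j\in\{1,\dots,n\}$, where $x_{i,k,j}=1$ means job $j$ is the $k$th job on machine $i$, such that: each job is assigned exactly once ($\sum_{i}\sum_{k}x_{i,k,j}=1$ for all $j$); each position holds at most one job ($\sum_j x_{i,k,j}\le 1$ for all $i,k$); and the occupied positions on each machine are consecutive starting from the first ($\sum_j x_{i,k+1,j}\le\sum_{j}x_{i,k,j}$ for all $i$ and $1\le k\le n-1$). Completion times: $C_{i,0}(x,r)=0$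 and $C_{i,k}(x,r)=\sum_{j=1}^n x_{i,k,j}\big(p_{i,j}+\max\{C_{i,k-1}(x,r),r_j\}\big)$ (so it is $0$ for an empty position). With $n_i=\sum_{k}\sum_{j}x_{i,k,j}$, the makespan is $C_{\max}(x,r)=\max_{i\in M}C_{i,n_i}(x,r)$. Let $C_{\max}(x_r^* )=\min_{x'}C_{\max}(x',r)$ be the optimal makespan under $r$, the minimum being over all schedules $x'$. The regret is $Q(x,r)=C_{\max}(x,r)-C_{\max}(x_r^* )$. A worst-case scenario for $x$ is a maximizer of $Q(x,r)$ over $r\in R$. *)

theory Defs
  imports "HOL-Analysis.Analysis"
begin

text \<open>Machines are \<open>{1..m}\<close>, jobs and positions are \<open>{1..n}\<close>. Arrays and scenarios are
  extensional functions on their index sets, so that each is represented by exactly one function.\<close>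

definition schedules :: "nat \<Rightarrow> nat \<Rightarrow> (nat \<times> nat \<times> nat \<Rightarrow> nat) set" where
  "schedules m n = {x \<in> {1..m} \<times> {1..n} \<times> {1..n} \<rightarrow>\<^sub>E {0, 1}.
     (\<forall>j\<in>{1..n}. (\<Sum>i=1..m. \<Sum>k=1..n. x (i, k, j)) = 1) \<and>
     (\<forall>i\<in>{1..m}. \<forall>k\<in>{1..n}. (\<Sum>j=1..n. x (i, k, j)) \<le> 1) \<and>
     (\<forall>i\<in>{1..m}. \<forall>k\<in>{1..<n}. (\<Sum>j=1..n. x (i, k + 1, j)) \<le> (\<Sum>j=1..n. x (i, k, j)))}"

primrec completion_time ::
  "nat \<Rightarrow> (nat \<Rightarrow> nat \<Rightarrow> real) \<Rightarrow> (nat \<times> nat \<times> nat \<Rightarrow> nat) \<Rightarrow> (nat \<Rightarrow> real) \<Rightarrow> nat \<Rightarrow> nat \<Rightarrow> real" where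
  "completion_time n p x r i 0 = 0"
| "completion_time n p x r i (Suc k) =
     (\<Sum>j=1..n. real (x (i, Suc k, j)) * (p i j + max (completion_time n p x r i k) (r j)))"

definition num_jobs :: "nat \<Rightarrow> (nat \<times> nat \<times> nat \<Rightarrow> nat) \<Rightarrow> nat \<Rightarrow> nat" where
  "num_jobs n x i = (\<Sum>k=1..n. \<Sum>j=1..n. x (i, k, j))"

definition makespan ::
  "nat \<Rightarrow> nat \<Rightarrow> (nat \<Rightarrow> nat \<Rightarrow> real) \<Rightarrow> (nat \<times> nat \<times> nat \<Rightarrow> nat) \<Rightarrow> (nat \<Rightarrow> real) \<Rightarrow> real" where
  "makespan m n p x r = Max ((\<lambda>i. completion_time n p x r i (num_jobs n x i)) ` {1..m})"

definition opt_makespan :: "nat \<Rightarrow> nat \<Rightarrow> (nat \<Rightarrow> nat \<Rightarrow> real) \<Rightarrow> (nat \<Rightarrow> real) \<Rightarrow> real" where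
  "opt_makespan m n p r = Min ((\<lambda>x'. makespan m n p x' r) ` schedules m n)"

definition regret ::
  "nat \<Rightarrow> nat \<Rightarrow> (nat \<Rightarrow> nat \<Rightarrow> real) \<Rightarrow> (nat \<times> nat \<times> nat \<Rightarrow> nat) \<Rightarrow> (nat \<Rightarrow> real) \<Rightarrow> real" where
  "regret m n p x r = makespan m n p x r - opt_makespan m n p r"

definition scenarios :: "nat \<Rightarrow> (nat \<Rightarrow> real) \<Rightarrow> (nat \<Rightarrow> real) \<Rightarrow> (nat \<Rightarrow> real) set" where
  "scenarios n rlo rhi = (\<Pi>\<^sub>E j\<in>{1..n}. {rlo j..rhi j})"

definition late_scenario :: "nat \<Rightarrow> (nat \<Rightarrow> real) \<Rightarrow> (nat \<Rightarrow> real) \<Rightarrow> nat \<Rightarrow> nat \<Rightarrow> real" where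
  "late_scenario n rlo rhi j = (\<lambda>t\<in>{1..n}. if t = j then rhi t else rlo t)"

definition late_scenarios :: "nat \<Rightarrow> (nat \<Rightarrow> real) \<Rightarrow> (nat \<Rightarrow> real) \<Rightarrow> (nat \<Rightarrow> real) set" where
  "late_scenarios n rlo rhi = late_scenario n rlo rhi ` {1..n}"

definition worst_case_scenario ::
  "nat \<Rightarrow> nat \<Rightarrow> (nat \<Rightarrow> nat \<Rightarrow> real) \<Rightarrow> (nat \<Rightarrow> real) \<Rightarrow> (nat \<Rightarrow> real) \<Rightarrow>
   (nat \<times> nat \<times> nat \<Rightarrow> nat) \<Rightarrow> (nat \<Rightarrow> real) \<Rightarrow> bool" where
  "worst_case_scenario m n p rlo rhi x r \<longleftrightarrow>
     is_arg_max (regret m n p x) (\<lambda>r. r \<in> scenarios n rlo rhi) r"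

end

theory Submission
  imports Defs
begin

text \<open>In a schedule \<open>x\<close> under a scenario \<open>r\<close>, the makespan is the release date of a critical
  job \<open>j\<close> plus the processing times from \<open>j\<close> onwards on its machine. Passing from \<open>r\<close> to the
  scenario where only \<open>j\<close> is late therefore increases the makespan of \<open>x\<close> by at least
  \<open>\<delta> = rhi j - r j\<close>. Since every release date increases by at most \<open>\<delta>\<close>, no schedule gets worse
  by more than \<open>\<delta>\<close>, hence neither does the optimum, and the regret does not decrease.\<close>

section \<open>Schedules and completion times\<close>

lemma finite_schedules: "finite (schedules m n)"
  unfolding schedules_def
  by (rule finite_subset[of _ "{1..m} \<times> {1..n} \<times> {1..n} \<rightarrow>\<^sub>E {0, 1}"]) (auto intro!: finite_PiE)

lemma num_jobs_le:
  assumes "x \<in> schedules m n" "i \<in> {1..m}"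
  shows "num_jobs n x i \<le> n"
proof -
  have "num_jobs n x i \<le> (\<Sum>k=1..n. 1)"
    unfolding num_jobs_def using assms by (intro sum_mono) (auto simp: schedules_def)
  then show ?thesis by simp
qed

text \<open>At most one entry at a position is 1, so the sum in the recursion collapses to one term
  or vanishes. Which case occurs, and for which \<open>j\<close>, depends on \<open>x\<close> alone;
  as \<open>r\<close> is quantified inside each case, the inductions below can compare one position
  under two scenarios.\<close>

lemma completion_time_Suc_cases:
  assumes "x \<in> schedules m n" "i \<in> {1..m}" "Suc k \<le> n"
  obtains (empty) "\<And>r. completion_time n p x r i (Suc k) = 0"
  | (job) j where "j \<in> {1..n}"
      "\<And>r. completion_time n p x r i (Suc k) = p i j + max (completion_time n p x r i k) (r j)"
proof (cases "\<forall>j\<in>{1..n}. x (i, Suc k, j) = 0")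
  case True
  then show ?thesis by (intro empty) simp
next
  case False
  then obtain j where j: "j \<in> {1..n}" "x (i, Suc k, j) \<noteq> 0" by blast
  have "(\<Sum>t=1..n. x (i, Suc k, t)) \<le> 1"
    using assms by (auto simp: schedules_def)
  moreover have "(\<Sum>t=1..n. x (i, Suc k, t)) = x (i, Suc k, j) + (\<Sum>t\<in>{1..n} - {j}. x (i, Suc k, t))"
    using j by (intro sum.remove) auto
  ultimately have one: "x (i, Suc k, j) = 1" and "(\<Sum>t\<in>{1..n} - {j}. x (i, Suc k, t)) = 0"
    using j by linarith+
  then have zero: "\<forall>t\<in>{1..n} - {j}. x (i, Suc k, t) = 0" by simp
  show ?thesis
  proof (rule job[OF j(1)])
    fix r
    have "completion_time n p x r i (Suc k) =
        real (x (i, Suc k, j)) * (p i j + max (completion_time n p x r i k) (r j)) +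
        (\<Sum>t\<in>{1..n} - {j}. real (x (i, Suc k, t)) * (p i t + max (completion_time n p x r i k) (r t)))"
      unfolding completion_time.simps using j by (intro sum.remove) auto
    then show "completion_time n p x r i (Suc k) = p i j + max (completion_time n p x r i k) (r j)"
      using one zero by simp
  qed
qed

lemma completion_time_nonneg:
  assumes "x \<in> schedules m n" "i \<in> {1..m}" "k \<le> n" "\<And>j. j \<in> {1..n} \<Longrightarrow> 0 \<le> p i j"
  shows "0 \<le> completion_time n p x r i k"
  using assms(3)
proof (induction k)
  case (Suc k)
  show ?case
  using assms(1,2) Suc.prems
  proof (cases rule: completion_time_Suc_cases[where p = p])
    case (job j)
    show ?thesis
      using Suc assms(4)[OF job(1)] unfolding job(2) by linarith
  qed simp
qed simp

text \<open>Adding \<delta> to both arguments of \<open>max\<close> adds \<delta> to the result, so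
  the delay is carried from position to position without growing. An empty position resets both
  sides to 0, which is where \<open>0 \<le> \<delta>\<close> enters.\<close>

lemma completion_time_le_add:
  assumes "x \<in> schedules m n" "i \<in> {1..m}" "k \<le> n"
    and "\<And>j. j \<in> {1..n} \<Longrightarrow> r' j \<le> r j + \<delta>" "0 \<le> \<delta>"
  shows "completion_time n p x r' i k \<le> completion_time n p x r i k + \<delta>"
  using assms(3)
proof (induction k)
  case (Suc k)
  show ?case
  using assms(1,2) Suc.prems
  proof (cases rule: completion_time_Suc_cases[where p = p])
    case (job j)
    show ?thesis
      using Suc assms(4)[OF job(1)] unfolding job(2) by linarith
  qed (use assms in simp)
qed (use assms in simp)

text \<open>The critical job starts the last block without idle time up to position
  \<open>k\<close>. If the job at \<open>k\<close> starts at its release date, it is critical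
  itself; otherwise it starts when its predecessor ends and inherits the critical job from
  there.\<close>

lemma completion_time_critical_job:
  assumes "x \<in> schedules m n" "i \<in> {1..m}" "k \<le> n" "\<And>j. j \<in> {1..n} \<Longrightarrow> 0 \<le> r j"
    and "completion_time n p x r i k \<noteq> 0"
  shows "\<exists>j\<in>{1..n}. \<forall>r'. completion_time n p x r i k + (r' j - r j) \<le> completion_time n p x r' i k"
  using assms(3,5)
proof (induction k)
  case (Suc k)
  show ?case
  using assms(1,2) Suc.prems(1)
  proof (cases rule: completion_time_Suc_cases[where p = p])
    case empty
    then show ?thesis using Suc.prems by simp
  next
    case (job j)
    show ?thesis
    proof (cases "completion_time n p x r i k \<le> r j")
      case True
      then show ?thesis
        unfolding job(2) by (intro bexI[OF _ job(1)]) linarith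
    next
      case False
      \<comment> \<open>The preceding completion time exceeds \<open>r j \<ge> 0\<close>, hence is
        nonzero, as the induction hypothesis demands.\<close>
      with assms(4)[OF job(1)] Suc obtain t where "t \<in> {1..n}"
        "\<And>r'. completion_time n p x r i k + (r' t - r t) \<le> completion_time n p x r' i k"
        by force
      with False show ?thesis
        unfolding job(2) by (intro bexI[of _ t]) (auto simp: max_def intro: order_trans)
    qed
  qed
qed simp

section \<open>Makespan\<close>

lemma completion_time_le_makespan:
  "i \<in> {1..m} \<Longrightarrow> completion_time n p x r i (num_jobs n x i) \<le> makespan m n p x r"
  unfolding makespan_def by (intro Max_ge) auto

lemma makespan_attained:
  assumes "m \<ge> 1"
  obtains i where "i \<in> {1..m}" "makespan m n p x r = completion_time n p x r i (num_jobs n x i)"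
proof -
  have "makespan m n p x r \<in> (\<lambda>i. completion_time n p x r i (num_jobs n x i)) ` {1..m}"
    unfolding makespan_def using assms by (intro Max_in) auto
  then show ?thesis using that by blast
qed

lemma makespan_nonneg:
  assumes "m \<ge> 1" "x \<in> schedules m n"
    and "\<And>i j. i \<in> {1..m} \<Longrightarrow> j \<in> {1..n} \<Longrightarrow> 0 \<le> p i j"
  shows "0 \<le> makespan m n p x r"
proof -
  obtain i where "i \<in> {1..m}" "makespan m n p x r = completion_time n p x r i (num_jobs n x i)"
    using makespan_attained[OF assms(1)] by blast
  then show ?thesis
    using completion_time_nonneg[OF assms(2) _ num_jobs_le[OF assms(2)]] assms(3) by simp
qed

lemma makespan_le_add:
  assumes "m \<ge> 1" "x \<in> schedules m n"
    and "\<And>j. j \<in> {1..n} \<Longrightarrow> r' j \<le> r j + \<delta>" "0 \<le> \<delta>"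
  shows "makespan m n p x r' \<le> makespan m n p x r + \<delta>"
proof -
  \<comment> \<open>The machine is chosen to attain the makespan under \<open>r'\<close>; under
    \<open>r\<close> its completion time only has to be bounded by the makespan.\<close>
  obtain i where i: "i \<in> {1..m}" "makespan m n p x r' = completion_time n p x r' i (num_jobs n x i)"
    using makespan_attained[OF assms(1)] by blast
  have "completion_time n p x r' i (num_jobs n x i) \<le> completion_time n p x r i (num_jobs n x i) + \<delta>"
    using i(1) assms by (intro completion_time_le_add) (auto intro: num_jobs_le)
  with i completion_time_le_makespan[OF i(1), of n p x r] show ?thesis by linarith
qed

lemma makespan_critical_job:
  assumes "m \<ge> 1" "x \<in> schedules m n" "\<And>j. j \<in> {1..n} \<Longrightarrow> 0 \<le> r j" "makespan m n p x r \<noteq> 0"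
  obtains j where "j \<in> {1..n}" "\<And>r'. makespan m n p x r + (r' j - r j) \<le> makespan m n p x r'"
proof -
  \<comment> \<open>Here the machine attains the makespan under \<open>r\<close>, and its critical
    job bounds the makespan under every \<open>r'\<close> from below.\<close>
  obtain i where i: "i \<in> {1..m}" "makespan m n p x r = completion_time n p x r i (num_jobs n x i)"
    using makespan_attained[OF assms(1)] by blast
  obtain j where "j \<in> {1..n}"
    "\<And>r'. makespan m n p x r + (r' j - r j) \<le> completion_time n p x r' i (num_jobs n x i)"
    using completion_time_critical_job[OF assms(2) i(1) num_jobs_le[OF assms(2) i(1)], of r p]
      assms(3,4) i(2) by auto
  then show ?thesis
    using that completion_time_le_makespan[OF i(1)] by (meson order_trans)
qed

section \<open>Optimal makespan\<close>

lemma opt_makespan_le: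
  "x \<in> schedules m n \<Longrightarrow> opt_makespan m n p r \<le> makespan m n p x r"
  unfolding opt_makespan_def by (intro Min_le) (auto simp: finite_schedules)

lemma opt_makespan_attained:
  assumes "schedules m n \<noteq> {}"
  obtains x where "x \<in> schedules m n" "opt_makespan m n p r = makespan m n p x r"
proof -
  have "opt_makespan m n p r \<in> (\<lambda>x. makespan m n p x r) ` schedules m n"
    unfolding opt_makespan_def using assms by (intro Min_in) (auto simp: finite_schedules)
  then show ?thesis using that by blast
qed

text \<open>A schedule optimal under \<open>r\<close> is still a candidate under \<open>r'\<close>,
  where it costs at most \<delta> more.\<close>

lemma opt_makespan_le_add:
  assumes "m \<ge> 1" "schedules m n \<noteq> {}" "\<And>j. j \<in> {1..n} \<Longrightarrow> r' j \<le> r j + \<delta>" "0 \<le> \<delta>"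
  shows "opt_makespan m n p r' \<le> opt_makespan m n p r + \<delta>"
proof -
  obtain x where x: "x \<in> schedules m n" "opt_makespan m n p r = makespan m n p x r"
    using opt_makespan_attained[OF assms(2)] by blast
  have "opt_makespan m n p r' \<le> makespan m n p x r'"
    using x(1) by (rule opt_makespan_le)
  also have "\<dots> \<le> makespan m n p x r + \<delta>"
    using assms x(1) by (intro makespan_le_add)
  finally show ?thesis
    using x(2) by simp
qed

section \<open>Regret and late scenarios\<close>

lemma late_scenario_in_scenarios:
  assumes "\<And>j. j \<in> {1..n} \<Longrightarrow> rlo j \<le> rhi j"
  shows "late_scenario n rlo rhi j \<in> scenarios n rlo rhi"
  using assms by (auto simp: late_scenario_def scenarios_def)

lemma regret_le_late_scenario:
  assumes "m \<ge> 1" "n \<ge> 1" "x \<in> schedules m n" "r \<in> scenarios n rlo rhi"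
    and p: "\<And>i j. i \<in> {1..m} \<Longrightarrow> j \<in> {1..n} \<Longrightarrow> 0 \<le> p i j"
    and rlo: "\<And>j. j \<in> {1..n} \<Longrightarrow> 0 \<le> rlo j"
  shows "\<exists>j\<in>{1..n}. regret m n p x r \<le> regret m n p x (late_scenario n rlo rhi j)"
proof (cases "makespan m n p x r = 0")
  \<comment> \<open>With zero makespan no critical job is available. The regret is then at most 0
    because the optimum is nonnegative, while any late scenario has nonnegative regret; job 1 is an
    arbitrary choice.\<close>
  case True
  obtain y where "y \<in> schedules m n" "opt_makespan m n p r = makespan m n p y r"
    using opt_makespan_attained assms(3) by blast
  then have "0 \<le> opt_makespan m n p r"
    using makespan_nonneg[OF assms(1)] p by simp
  then have "regret m n p x r \<le> regret m n p x (late_scenario n rlo rhi 1)"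
    using True opt_makespan_le[OF assms(3), of p "late_scenario n rlo rhi 1"]
    by (simp add: regret_def)
  then show ?thesis using \<open>n \<ge> 1\<close> by (intro bexI[of _ 1]) auto
next
  case False
  have r: "rlo t \<le> r t" "r t \<le> rhi t" if "t \<in> {1..n}" for t
    using assms(4) that by (auto simp: scenarios_def dest!: PiE_mem)
  have r_nonneg: "0 \<le> r t" if "t \<in> {1..n}" for t
    using r(1)[OF that] rlo[OF that] by linarith
  obtain j where j: "j \<in> {1..n}"
    "\<And>r'. makespan m n p x r + (r' j - r j) \<le> makespan m n p x r'"
    using makespan_critical_job[OF assms(1,3) r_nonneg False] by metis
  let ?late = "late_scenario n rlo rhi j"
  have "makespan m n p x r + (rhi j - r j) \<le> makespan m n p x ?late"
    using j(2)[of ?late] j(1) by (simp add: late_scenario_def)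
  moreover have "opt_makespan m n p ?late \<le> opt_makespan m n p r + (rhi j - r j)"
  proof (rule opt_makespan_le_add)
    \<comment> \<open>For \<open>t = j\<close> the bound is an equality; any other job moves down to
      \<open>rlo t \<le> r t\<close>, and the added amount is nonnegative.\<close>
    fix t assume t: "t \<in> {1..n}"
    show "?late t \<le> r t + (rhi j - r j)"
      using r[OF t] r[OF j(1)] t by (auto simp: late_scenario_def)
  qed (use assms r[OF j(1)] in auto)
  ultimately show ?thesis
    using j(1) by (intro bexI[of _ j]) (auto simp: regret_def)
qed

theorem mainTheorem1:
  fixes m n :: nat
    and p :: "nat \<Rightarrow> nat \<Rightarrow> real"
    and rlo rhi :: "nat \<Rightarrow> real"
    and x :: "nat \<times> nat \<times> nat \<Rightarrow> nat"
  assumes "m \<ge> 1" and "n \<ge> 1"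
    and "\<And>i j. i \<in> {1..m} \<Longrightarrow> j \<in> {1..n} \<Longrightarrow> p i j > 0"
    and "\<And>j. j \<in> {1..n} \<Longrightarrow> 0 \<le> rlo j \<and> rlo j < rhi j"
    and "x \<in> schedules m n"
  shows "(\<exists>r\<in>late_scenarios n rlo rhi. worst_case_scenario m n p rlo rhi x r) \<and>
    (SUP r\<in>scenarios n rlo rhi. regret m n p x r) = Max (regret m n p x ` late_scenarios n rlo rhi)"
proof -
  let ?Q = "regret m n p x" and ?L = "late_scenarios n rlo rhi" and ?R = "scenarios n rlo rhi"
  have L: "finite ?L" "?L \<noteq> {}" "?L \<subseteq> ?R"
    using assms(2,4) by (auto simp: late_scenarios_def less_imp_le intro!: late_scenario_in_scenarios)
  have le_Max: "?Q r \<le> Max (?Q ` ?L)" if r: "r \<in> ?R" for r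
  proof -
    have "\<exists>j\<in>{1..n}. ?Q r \<le> ?Q (late_scenario n rlo rhi j)"
      using assms(3,4) by (intro regret_le_late_scenario[OF assms(1,2,5) r]) (simp_all add: less_imp_le)
    then obtain j where "j \<in> {1..n}" "?Q r \<le> ?Q (late_scenario n rlo rhi j)"
      by blast
    moreover from this L(1) have "?Q (late_scenario n rlo rhi j) \<le> Max (?Q ` ?L)"
      by (intro Max_ge) (auto simp: late_scenarios_def)
    ultimately show ?thesis by linarith
  qed
  have "Max (?Q ` ?L) \<in> ?Q ` ?L"
    using L by (intro Max_in) auto
  then obtain w where w: "w \<in> ?L" "Max (?Q ` ?L) = ?Q w"
    by blast
  have "worst_case_scenario m n p rlo rhi x w"
    using w le_Max L(3) by (force simp: worst_case_scenario_def is_arg_max_def not_less)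
  \<comment> \<open>The supremum ranges over an infinite set, but \<open>w\<close> lies in it and
    attains the upper bound, so the supremum is a maximum.\<close>
  moreover have "(SUP r\<in>?R. ?Q r) = Max (?Q ` ?L)"
    using w L(3) le_Max by (intro cSup_eq_maximum) auto
  ultimately show ?thesis using w(1) by blast
qed

end
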